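(* The pigeonhole formulas $\mathrm{PHP}^{n+1}_n$ ($n\ge 1$) have Circular Resolution refutations of length polynomial in $n$; that is, there is a polynomial $p$ such that for every $n\ge 1$ there is a Circular Resolution refutation of $\mathrm{PHP}^{n+1}_n$ of length at most $p(n)$.
   Context: Pigeonhole formula. $\mathrm{PHP}^{n+1}_n$ is the CNF formula with variables $X_{u,v}$ for $u\in\{1,\dots,n+1\}$ and $v\in\{1,\dots,n\}$ and clauses: $X_{u,1}\vee\cdots\vee X_{u,n}$ for each $u$; and $\overline{X_{u_1,v}}\vee\overline{X_{u_2,v}}$ for all $u_1\neq u_2$ and all $v$. Circular Resolution. A literal is a propositional variable $X$ or its negation $\overline{X}$. A clause is a finite set of literals read as a disjunction; $0$ denotes the empty clause. The rules are, for clauses $C$ and variables $X$: axiom (no premises, conclusion $X\vee\overline{X}$); symmetric cut (premises $C\vee X$ and $C\vee\overline{X}$, conclusion $C$); split (premise $C$, two conclusions $C\vee X$ and $C\vee\overline{X}$). A circular pre-proof $\Pi$ is a finite directed bipartite graph with formula-vertices (set $J$), each labelled by a clause (labels may repeat), and inference-vertices (set $I$), each labelled by an instance of a rule whose premises are the labels of its in-neighbours and whose conclusions are the labels of its out-neighbours (one in-neighbour per premise, one out-neighbour per conclusion); cycles are allowed. A flow assignment is a map $F:I\to\mathbb{R}^+$ to the positive reals; the balance of $u\in J$ is $B(u)=\sum_{w\in N^-(u)}F(w)-\sum_{w\in N^+(u)}F(w)$, where $N^-(u),N^+(u)$ are the sets of in- and out-neighbours of $u$. Sources are the formula-vertices of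 negative balance, sinks those of positive balance. $\Pi$ is a Circular Resolution proof of a clause $A$ from a set of clauses $\mathscr{H}$ if there is a flow assignment for which every source is labelled by a clause in $\mathscr{H}$ and some sink is labelled by $A$. A refutation of $\mathscr{H}$ is a proof of the empty clause $0$ from $\mathscr{H}$. The length of the proof is its number of vertices. *)

theory Defs
  imports
    "HOL-Library.FSet"
    "HOL-Library.Multiset"
    "HOL-Computational_Algebra.Polynomial"
    "Graph_Theory.Pair_Digraph"
begin

datatype 'x literal = Pos 'x | Neg 'x

text \<open>The empty clause is \<open>{||}\<close>.\<close>

type_synonym 'x clause = "'x literal fset"

text \<open>
  Rule instances. No side condition relates \<open>C\<close> and \<open>X\<close>, so \<open>C \<or> X\<close> may coincide with \<open>C\<close>.
  Premises and conclusions are multisets: when two of them coincide as clauses they are still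
  two premises (conclusions).
\<close>

datatype 'x inference = Axiom 'x | Cut "'x clause" 'x | Split "'x clause" 'x

fun rule_premises :: "'x inference \<Rightarrow> 'x clause multiset" where
  "rule_premises (Axiom X) = {#}"
| "rule_premises (Cut C X) = {# finsert (Pos X) C, finsert (Neg X) C #}"
| "rule_premises (Split C X) = {# C #}"

fun rule_conclusions :: "'x inference \<Rightarrow> 'x clause multiset" where
  "rule_conclusions (Axiom X) = {# {| Pos X, Neg X |} #}"
| "rule_conclusions (Cut C X) = {# C #}"
| "rule_conclusions (Split C X) = {# finsert (Pos X) C, finsert (Neg X) C #}"

record ('v, 'x) preproof =
  proof_graph :: "'v pair_pre_digraph"
  formula_verts :: "'v set"
  inference_verts :: "'v set"
  clause_at :: "'v \<Rightarrow> 'x clause"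
  inference_at :: "'v \<Rightarrow> 'x inference"

definition in_nbrs :: "('v, 'x) preproof \<Rightarrow> 'v \<Rightarrow> 'v set" where
  "in_nbrs P w = {u. (u, w) \<in> parcs (proof_graph P)}"

definition out_nbrs :: "('v, 'x) preproof \<Rightarrow> 'v \<Rightarrow> 'v set" where
  "out_nbrs P w = {u. (w, u) \<in> parcs (proof_graph P)}"

text \<open>
  The multiset equations say that labelling matches the distinct in-neighbours (out-neighbours)
  of an inference-vertex one-to-one with the premises (conclusions) of its rule instance.
\<close>

definition circular_preproof :: "('v, 'x) preproof \<Rightarrow> bool" where
  "circular_preproof P \<longleftrightarrow>
     pair_fin_digraph (proof_graph P) \<and>
     formula_verts P \<union> inference_verts P = pverts (proof_graph P) \<and>
     formula_verts P \<inter> inference_verts P = {} \<and>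
     parcs (proof_graph P) \<subseteq>
       formula_verts P \<times> inference_verts P \<union> inference_verts P \<times> formula_verts P \<and>
     (\<forall>w \<in> inference_verts P.
        image_mset (clause_at P) (mset_set (in_nbrs P w)) = rule_premises (inference_at P w) \<and>
        image_mset (clause_at P) (mset_set (out_nbrs P w)) = rule_conclusions (inference_at P w))"

definition flow_assignment :: "('v, 'x) preproof \<Rightarrow> ('v \<Rightarrow> real) \<Rightarrow> bool" where
  "flow_assignment P F \<longleftrightarrow> (\<forall>w \<in> inference_verts P. F w > 0)"

definition balance :: "('v, 'x) preproof \<Rightarrow> ('v \<Rightarrow> real) \<Rightarrow> 'v \<Rightarrow> real" where
  "balance P F u = (\<Sum>w \<in> in_nbrs P u. F w) - (\<Sum>w \<in> out_nbrs P u. F w)"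

definition sources :: "('v, 'x) preproof \<Rightarrow> ('v \<Rightarrow> real) \<Rightarrow> 'v set" where
  "sources P F = {u \<in> formula_verts P. balance P F u < 0}"

definition sinks :: "('v, 'x) preproof \<Rightarrow> ('v \<Rightarrow> real) \<Rightarrow> 'v set" where
  "sinks P F = {u \<in> formula_verts P. balance P F u > 0}"

definition circular_proof ::
  "('v, 'x) preproof \<Rightarrow> 'x clause set \<Rightarrow> 'x clause \<Rightarrow> bool" where
  "circular_proof P H A \<longleftrightarrow>
     circular_preproof P \<and>
     (\<exists>F. flow_assignment P F \<and>
          (\<forall>u \<in> sources P F. clause_at P u \<in> H) \<and>
          (\<exists>u \<in> sinks P F. clause_at P u = A))"

definition circular_refutation :: "('v, 'x) preproof \<Rightarrow> 'x clause set \<Rightarrow> bool" where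
  "circular_refutation P H \<longleftrightarrow> circular_proof P H {||}"

definition proof_length :: "('v, 'x) preproof \<Rightarrow> nat" where
  "proof_length P = card (pverts (proof_graph P))"

text \<open>\<open>PHP n\<close> has \<open>n + 1\<close> pigeons and \<open>n\<close> holes; the pair \<open>(u, v)\<close> is the variable \<open>X\<^sub>u\<^sub>,\<^sub>v\<close>.\<close>

definition PHP :: "nat \<Rightarrow> (nat \<times> nat) clause set" where
  "PHP n =
     {(\<lambda>v. Pos (u, v)) |`| fset_of_list [1..<n + 1] | u. u \<in> {1..n + 1}} \<union>
     {{| Neg (u1, v), Neg (u2, v) |} | u1 u2 v.
        u1 \<in> {1..n + 1} \<and> u2 \<in> {1..n + 1} \<and> u1 \<noteq> u2 \<and> v \<in> {1..n}}"

end

theory Submission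
  imports Defs
begin

text \<open>
  Read a clause as the indicator of its falsity, so that split and cut both express
  \<open>C = (C \<or> X) + (C \<or> \<not>X)\<close>, and a flow is an inequality between sums of clauses. The pigeon axiom of
  \<open>u\<close> turns the clauses \<open>\<not>X\<^sub>u\<^sub>,\<^sub>v\<close> (all \<open>v\<close>) into the empty clause; the hole axioms of \<open>v\<close> turn one copy
  of the empty clause into the clauses \<open>\<not>X\<^sub>u\<^sub>,\<^sub>v\<close> (all \<open>u\<close>), by splitting it along \<open>X\<^sub>1\<^sub>,\<^sub>v, X\<^sub>2\<^sub>,\<^sub>v, \<dots>\<close>.
  Hence \<open>n\<close> copies of the empty clause yield \<open>n + 1\<close> copies, and feeding \<open>n\<close> of them back leaves a
  positive balance of \<open>1\<close>. All inferences have integer flow, so it suffices to count them with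
  multiplicity.
\<close>

section \<open>A multiset calculus for circular derivations\<close>

abbreviation all_premises :: "'x inference multiset \<Rightarrow> 'x clause multiset" where
  "all_premises M \<equiv> \<Sum>\<^sub># (image_mset rule_premises M)"

abbreviation all_conclusions :: "'x inference multiset \<Rightarrow> 'x clause multiset" where
  "all_conclusions M \<equiv> \<Sum>\<^sub># (image_mset rule_conclusions M)"

text \<open>
  The instances whose premises (conclusions) are pairwise distinct clauses; only these can be drawn
  in a graph that has a single vertex per clause.
\<close>

fun proper :: "'x inference \<Rightarrow> bool" where
  "proper (Axiom X) \<longleftrightarrow> True"
| "proper (Cut C X) \<longleftrightarrow> \<not> (Pos X |\<in>| C \<and> Neg X |\<in>| C)"
| "proper (Split C X) \<longleftrightarrow> \<not> (Pos X |\<in>| C \<and> Neg X |\<in>| C)"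

text \<open>\<open>M\<close> is an integral flow, each inference counted as often as it is used, and
  \<open>N\<close> collects the uses of hypotheses. The inclusion is the balance condition clause by
  clause; being an inclusion, it lets surplus clauses be discarded. Nothing orders the inferences,
  so cycles are built in.\<close>

definition derives ::
  "'x clause set \<Rightarrow> nat \<Rightarrow> 'x clause multiset \<Rightarrow> 'x clause multiset \<Rightarrow> bool" where
  "derives H k A B \<longleftrightarrow> (\<exists>M N. size M \<le> k \<and> (\<forall>i \<in># M. proper i) \<and> set_mset N \<subseteq> H \<and>
     B + all_premises M \<subseteq># A + N + all_conclusions M)"

lemma derives_mono: "derives H k A B \<Longrightarrow> k \<le> l \<Longrightarrow> derives H l A B"
  unfolding derives_def by (meson order_trans)

lemma derives_refl: "derives H 0 A A"
  unfolding derives_def by (rule exI[of _ "{#}"], rule exI[of _ "{#}"]) simp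

lemma derives_hypothesis: "C \<in> H \<Longrightarrow> derives H 0 {#} {#C#}"
  unfolding derives_def by (rule exI[of _ "{#}"], rule exI[of _ "{#C#}"]) simp

lemma derives_add:
  assumes "derives H k A B" "derives H l C D"
  shows "derives H (k + l) (A + C) (B + D)"
proof -
  obtain M N where 1: "size M \<le> k" "\<forall>i \<in># M. proper i" "set_mset N \<subseteq> H"
    "B + all_premises M \<subseteq># A + N + all_conclusions M"
    using assms(1) unfolding derives_def by blast
  obtain M' N' where 2: "size M' \<le> l" "\<forall>i \<in># M'. proper i" "set_mset N' \<subseteq> H"
    "D + all_premises M' \<subseteq># C + N' + all_conclusions M'"
    using assms(2) unfolding derives_def by blast
  have "B + D + all_premises (M + M') \<subseteq># A + C + (N + N') + all_conclusions (M + M')"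
    using subset_mset.add_mono[OF 1(4) 2(4)] by (simp add: ac_simps)
  moreover have "size (M + M') \<le> k + l" "\<forall>i \<in># M + M'. proper i" "set_mset (N + N') \<subseteq> H"
    using 1 2 by auto
  ultimately show ?thesis
    unfolding derives_def by blast
qed

text \<open>This is where circularity enters: conclusions may be fed back as premises.\<close>

lemma derives_cancel:
  assumes "derives H k (A + C) (B + C)"
  shows "derives H k A B"
proof -
  obtain M N where 1: "size M \<le> k" "\<forall>i \<in># M. proper i" "set_mset N \<subseteq> H"
    "B + C + all_premises M \<subseteq># A + C + N + all_conclusions M"
    using assms unfolding derives_def by blast
  have "C + (B + all_premises M) \<subseteq># C + (A + N + all_conclusions M)"
    using 1(4) by (simp add: ac_simps)
  then have "B + all_premises M \<subseteq># A + N + all_conclusions M"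
    by (simp only: subset_mset.add_le_cancel_left)
  with 1 show ?thesis
    unfolding derives_def by blast
qed

text \<open>Adding the two derivations puts \<open>B\<close> on both sides, where it
  cancels.\<close>

lemma derives_trans:
  assumes "derives H k A B" "derives H l B C"
  shows "derives H (k + l) A C"
proof (rule derives_cancel)
  show "derives H (k + l) (A + B) (C + B)"
    using derives_add[OF assms] by (simp add: add.commute)
qed

lemma derives_sum:
  assumes "\<And>a. a \<in> S \<Longrightarrow> derives H k (f a) (g a)"
  shows "derives H (card S * k) (sum f S) (sum g S)"
  using assms
proof (induction S rule: infinite_finite_induct)
  case (insert a S)
  have "derives H (k + card S * k) (f a + sum f S) (g a + sum g S)"
    by (intro derives_add insert.IH insert.prems) auto
  with insert.hyps show ?case by simp
qed (simp_all add: derives_refl)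

text \<open>The side condition makes \<open>Cut C X\<close> proper.\<close>

lemma derives_cut:
  assumes "Neg X |\<notin>| C"
  shows "derives H 1 {# finsert (Pos X) C, finsert (Neg X) C #} {#C#}"
  unfolding derives_def using assms
  by (intro exI[of _ "{#Cut C X#}"] exI[of _ "{#}"]) simp

lemma derives_split:
  assumes "Neg X |\<notin>| C"
  shows "derives H 1 {#C#} {# finsert (Pos X) C, finsert (Neg X) C #}"
  unfolding derives_def using assms
  by (intro exI[of _ "{#Split C X#}"] exI[of _ "{#}"]) simp

text \<open>A split whose negative half is discarded.\<close>

lemma derives_weakening:
  assumes "Neg X |\<notin>| C"
  shows "derives H 1 {#C#} {# finsert (Pos X) C #}"
  unfolding derives_def using assms
  by (intro exI[of _ "{#Split C X#}"] exI[of _ "{#}"]) simp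

section \<open>Pigeon and hole constraints over a sequence of variables\<close>

text \<open>Serves both as a prefix of a pigeon axiom and as the all-positive branch left after
  splitting the empty clause along a hole.\<close>

definition pos_upto :: "(nat \<Rightarrow> 'x) \<Rightarrow> nat \<Rightarrow> 'x clause" where
  "pos_upto x k = (\<lambda>i. Pos (x i)) |`| fset_of_list [1..<k + 1]"

lemma pos_upto_0 [simp]: "pos_upto x 0 = {||}"
  by (simp add: pos_upto_def)

lemma pos_upto_Suc [simp]: "pos_upto x (Suc k) = finsert (Pos (x (Suc k))) (pos_upto x k)"
  by (simp add: pos_upto_def)

lemma Neg_notin_pos_upto [simp]: "Neg y |\<notin>| pos_upto x k"
  by (auto simp: pos_upto_def)

lemma derives_weakening_upto:
  assumes "\<forall>i \<in> {1..k}. Neg (x i) |\<notin>| C"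
  shows "derives H k {#C#} {# pos_upto x k |\<union>| C #}"
  using assms
proof (induction k)
  case (Suc k)
  have "derives H 1 {# pos_upto x k |\<union>| C #} {# finsert (Pos (x (Suc k))) (pos_upto x k |\<union>| C) #}"
    using Suc.prems by (intro derives_weakening) auto
  from derives_trans[OF Suc.IH this] show ?case
    using Suc.prems by simp
qed (simp add: derives_refl)

text \<open>The literals are cut away from the last to the first. Before its cut, the clause with
  \<open>Neg (x i)\<close> is weakened by the \<open>i - 1\<close> positive literals still present,
  so step \<open>i\<close> costs \<open>i\<close> inferences. The side clause \<open>D\<close> is
  empty for pigeons and a single negative literal for holes.\<close>

lemma derives_resolve_upto:
  assumes "inj_on x {1..k}" "\<forall>i \<in> {1..k}. Neg (x i) |\<notin>| D"
  shows "derives H (k * k)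
    ({# pos_upto x k |\<union>| D #} + (\<Sum>i = 1..k. {# finsert (Neg (x i)) D #})) {#D#}"
  using assms
proof (induction k)
  case (Suc k)
  let ?C = "pos_upto x k |\<union>| D" and ?y = "x (Suc k)"
  let ?S = "\<Sum>i = 1..k. {# finsert (Neg (x i)) D #}"
  \<comment> \<open>Injectivity keeps the weakening splits proper: none of their variables is
    \<open>?y\<close>.\<close>
  have "?y \<noteq> x i" if "i \<in> {1..k}" for i
    using inj_onD[OF Suc.prems(1), of "Suc k" i] that by auto
  then have "\<forall>i \<in> {1..k}. Neg (x i) |\<notin>| finsert (Neg ?y) D"
    using Suc.prems(2) by fastforce
  from derives_weakening_upto[OF this]
  have weak: "derives H k {# finsert (Neg ?y) D #} {# finsert (Neg ?y) ?C #}"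
    by simp
  have "derives H 1 {# finsert (Pos ?y) ?C, finsert (Neg ?y) ?C #} {#?C#}"
    using Suc.prems(2) by (intro derives_cut) auto
  then have cut: "derives H 1 ({# finsert (Neg ?y) ?C #} + {# finsert (Pos ?y) ?C #}) {#?C#}"
    by (simp add: add_mset_commute)
  from derives_trans[OF derives_add[OF weak derives_refl] cut]
  have "derives H (k + 0 + 1) ({# finsert (Neg ?y) D #} + {# finsert (Pos ?y) ?C #}) {#?C#}" .
  from derives_add[OF this derives_refl[of H ?S]]
  have "derives H (k + 1) ({# finsert (Neg ?y) D #} + {# finsert (Pos ?y) ?C #} + ?S) ({#?C#} + ?S)"
    by simp
  moreover have "derives H (k * k) ({#?C#} + ?S) {#D#}"
    using Suc.prems by (intro Suc.IH) (auto intro: inj_on_subset)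
  ultimately have "derives H (k + 1 + k * k)
      ({# finsert (Neg ?y) D #} + {# finsert (Pos ?y) ?C #} + ?S) {#D#}"
    by (rule derives_trans)
  moreover have "{# finsert (Neg ?y) D #} + {# finsert (Pos ?y) ?C #} + ?S =
      {# pos_upto x (Suc k) |\<union>| D #} + (\<Sum>i = 1..Suc k. {# finsert (Neg (x i)) D #})"
    by (simp add: ac_simps add_mset_commute)
  ultimately have "derives H (k + 1 + k * k)
      ({# pos_upto x (Suc k) |\<union>| D #} + (\<Sum>i = 1..Suc k. {# finsert (Neg (x i)) D #})) {#D#}"
    by (simp only:)
  then show ?case
    by (rule derives_mono) simp
qed (simp add: derives_refl)

lemma derives_at_least_one:
  assumes "inj_on x {1..k}" "pos_upto x k \<in> H"
  shows "derives H (k * k) (\<Sum>i = 1..k. {# {| Neg (x i) |} #}) {# {||} #}"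
proof -
  have "derives H 0 (\<Sum>i = 1..k. {# {| Neg (x i) |} #})
      ({# pos_upto x k #} + (\<Sum>i = 1..k. {# {| Neg (x i) |} #}))"
    using derives_add[OF derives_hypothesis[OF assms(2)] derives_refl] by simp
  from derives_trans[OF this] show ?thesis
    using derives_resolve_upto[OF assms(1), of "{||}" H] by simp
qed

text \<open>The all-positive branch is kept so that the induction can split it again. Its new
  negative half, resolved with the hole axioms containing \<open>Neg ?y\<close>, becomes the unit
  clause of \<open>?y\<close>; its positive half is the next branch.\<close>

lemma derives_at_most_one:
  assumes "inj_on x {1..k}"
    and "\<And>i j. i \<in> {1..k} \<Longrightarrow> j \<in> {1..k} \<Longrightarrow> i \<noteq> j \<Longrightarrow> {| Neg (x i), Neg (x j) |} \<in> H"
  shows "derives H (k ^ 3) {# {||} #}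
    ({# pos_upto x k #} + (\<Sum>i = 1..k. {# {| Neg (x i) |} #}))"
  using assms
proof (induction k)
  case (Suc k)
  let ?C = "pos_upto x k" and ?y = "x (Suc k)"
  let ?S = "\<Sum>i = 1..k. {# {| Neg (x i) |} #}"
  let ?T = "\<Sum>i = 1..k. {# {| Neg (x i), Neg ?y |} #}"
  have injk: "inj_on x {1..k}"
    using Suc.prems(1) by (rule inj_on_subset) auto
  have IH: "derives H (k ^ 3) {# {||} #} ({#?C#} + ?S)"
    using Suc.prems injk by (intro Suc.IH) auto
  have ne: "x i \<noteq> ?y" if "i \<in> {1..k}" for i
    using inj_onD[OF Suc.prems(1), of "Suc k" i] that by auto
  have "derives H (card {1..k} * 0) (\<Sum>i = 1..k. {#}) ?T"
    by (intro derives_sum derives_hypothesis Suc.prems(2)) auto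
  then have "derives H 0 {#} ?T"
    by simp
  from derives_add[OF derives_refl[of H "{# finsert (Neg ?y) ?C #}"] this]
  have "derives H 0 {# finsert (Neg ?y) ?C #} ({# finsert (Neg ?y) ?C #} + ?T)"
    by simp
  moreover have "derives H (k * k) ({# finsert (Neg ?y) ?C #} + ?T) {# {| Neg ?y |} #}"
    using derives_resolve_upto[OF injk, of "{| Neg ?y |}" H] ne by simp
  ultimately have res: "derives H (0 + k * k) {# finsert (Neg ?y) ?C #} {# {| Neg ?y |} #}"
    by (rule derives_trans)
  have split: "derives H 1 {#?C#} {# finsert (Pos ?y) ?C, finsert (Neg ?y) ?C #}"
    by (intro derives_split) auto
  have "derives H (0 + (0 + k * k)) {# finsert (Pos ?y) ?C, finsert (Neg ?y) ?C #}
      {# finsert (Pos ?y) ?C, {| Neg ?y |} #}"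
    using derives_add[OF derives_refl[of H "{# finsert (Pos ?y) ?C #}"] res]
    by (simp add: add_mset_commute)
  from derives_trans[OF split this]
  have "derives H (1 + k * k) {#?C#} {# finsert (Pos ?y) ?C, {| Neg ?y |} #}"
    by simp
  from derives_trans[OF IH derives_add[OF this derives_refl[of H ?S]]]
  have "derives H (k ^ 3 + (1 + k * k)) {# {||} #}
      ({# finsert (Pos ?y) ?C, {| Neg ?y |} #} + ?S)"
    by simp
  then have "derives H (Suc k ^ 3) {# {||} #} ({# finsert (Pos ?y) ?C, {| Neg ?y |} #} + ?S)"
    \<comment> \<open>The step cost \<open>1 + k * k\<close> is at most the difference of
      consecutive cubes, \<open>3 * k^2 + 3 * k + 1\<close>.\<close>
    by (rule derives_mono) (simp add: power3_eq_cube algebra_simps)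
  then show ?case
    by (simp add: add_mset_commute)
qed (simp add: derives_refl)

lemma derives_at_most_one':
  assumes "inj_on x {1..k}"
    and "\<And>i j. i \<in> {1..k} \<Longrightarrow> j \<in> {1..k} \<Longrightarrow> i \<noteq> j \<Longrightarrow> {| Neg (x i), Neg (x j) |} \<in> H"
  shows "derives H (k ^ 3) {# {||} #} (\<Sum>i = 1..k. {# {| Neg (x i) |} #})"
proof -
  have "derives H 0 {# pos_upto x k #} {#}"
    unfolding derives_def by (rule exI[of _ "{#}"], rule exI[of _ "{#}"]) simp
  from derives_trans[OF derives_at_most_one[OF assms]
      derives_add[OF this derives_refl[of H "\<Sum>i = 1..k. {# {| Neg (x i) |} #}"]]]
  show ?thesis by simp
qed

section \<open>The pigeonhole formulas in the calculus\<close>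

lemma pigeon_in_PHP: "u \<in> {1..n + 1} \<Longrightarrow> pos_upto (\<lambda>v. (u, v)) n \<in> PHP n"
  unfolding PHP_def pos_upto_def
  by (rule UnI1, rule CollectI, rule exI[of _ u]) (intro conjI refl)

lemma hole_in_PHP:
  assumes "u1 \<in> {1..n + 1}" "u2 \<in> {1..n + 1}" "u1 \<noteq> u2" "v \<in> {1..n}"
  shows "{| Neg (u1, v), Neg (u2, v) |} \<in> PHP n"
  unfolding PHP_def
  by (rule UnI2, rule CollectI, rule exI[of _ u1], rule exI[of _ u2], rule exI[of _ v])
    (intro conjI refl assms)

lemma derives_PHP:
  "derives (PHP n) (n * (n + 1) ^ 3 + (n + 1) * (n * n)) {#} {# {||} #}"
proof -
  define X where "X u v = {# {| Neg (u, v) |} #}" for u v :: nat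
  define Us where "Us = {1..n + 1}"
  define Vs where "Vs = {1..n}"
  have card: "card Us = n + 1" "card Vs = n"
    by (simp_all add: Us_def Vs_def)
  have holes: "derives (PHP n) ((n + 1) ^ 3) {# {||} #} (\<Sum>u \<in> Us. X u v)" if "v \<in> Vs" for v
    unfolding X_def Us_def
  proof (rule derives_at_most_one'[where x = "\<lambda>u. (u, v)"])
    show "inj_on (\<lambda>u. (u, v)) {1..n + 1}"
      by (simp add: inj_on_def)
    show "{| Neg (i, v), Neg (j, v) |} \<in> PHP n"
      if "i \<in> {1..n + 1}" "j \<in> {1..n + 1}" "i \<noteq> j" for i j
      using that \<open>v \<in> Vs\<close> unfolding Vs_def by (rule hole_in_PHP)
  qed
  have pigeons: "derives (PHP n) (n * n) (\<Sum>v \<in> Vs. X u v) {# {||} #}" if "u \<in> Us" for u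
    unfolding X_def Vs_def
  proof (rule derives_at_least_one[where x = "\<lambda>v. (u, v)"])
    show "inj_on (\<lambda>v. (u, v)) {1..n}"
      by (simp add: inj_on_def)
  qed (use that in \<open>simp only: Us_def pigeon_in_PHP\<close>)
  have "derives (PHP n) (card Vs * (n + 1) ^ 3) (\<Sum>v \<in> Vs. {# {||} #})
      (\<Sum>v \<in> Vs. \<Sum>u \<in> Us. X u v)"
    using holes by (rule derives_sum)
  moreover have "derives (PHP n) (card Us * (n * n)) (\<Sum>u \<in> Us. \<Sum>v \<in> Vs. X u v)
      (\<Sum>u \<in> Us. {# {||} #})"
    using pigeons by (rule derives_sum)
  ultimately have "derives (PHP n) (card Vs * (n + 1) ^ 3 + card Us * (n * n))
      (\<Sum>v \<in> Vs. {# {||} #}) (\<Sum>u \<in> Us. {# {||} #})"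
    \<comment> \<open>The same unit clauses are produced hole by hole and consumed pigeon by
      pigeon.\<close>
    unfolding sum.swap[of X Vs Us] by (rule derives_trans)
  moreover have "(\<Sum>u \<in> Us. {# {||} #}) = {# {||} #} + (\<Sum>v \<in> Vs. {# {||} :: (nat \<times> nat) clause #})"
    by (simp add: Us_def Vs_def)
  ultimately show ?thesis
    unfolding card by - (rule derives_cancel[where C = "\<Sum>v \<in> Vs. {# {||} #}"], simp)
qed

section \<open>From multisets of inferences to circular proofs\<close>

text \<open>If \<open>C\<close> with \<open>Pos X\<close> added equals \<open>C\<close> with
  \<open>Neg X\<close> added, then both literals lie in \<open>C\<close>, which properness
  excludes.\<close>

lemma proper_distinct:
  assumes "proper i"
  shows "mset_set (set_mset (rule_premises i)) = rule_premises i"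
    and "mset_set (set_mset (rule_conclusions i)) = rule_conclusions i"
proof -
  have ne: "finsert (Pos X) C \<noteq> finsert (Neg X) C" if "\<not> (Pos X |\<in>| C \<and> Neg X |\<in>| C)"
    for X :: 'a and C
    using that by (metis finsert_iff literal.distinct(1))
  show "mset_set (set_mset (rule_premises i)) = rule_premises i"
    using assms ne by (cases i) auto
  show "mset_set (set_mset (rule_conclusions i)) = rule_conclusions i"
    using assms ne by (cases i) auto
qed

lemma card_set_mset_le: "card (set_mset M) \<le> size M"
  by (induction M) (auto simp: card_insert_if)

lemma size_rule: "size (rule_premises i) + size (rule_conclusions i) \<le> 3"
  by (cases i) auto

lemma size_all:
  "size (all_premises M + all_conclusions M) \<le> 3 * size M"
proof (induction M)
  case (add i M)
  then show ?case using size_rule[of i] by simp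
qed simp

text \<open>Without repetitions, an inference contributes to \<open>c\<close> exactly its own
  multiplicity. The right-hand side is the flow through the edges at the vertex of
  \<open>c\<close>.\<close>

lemma count_sum_image_mset:
  assumes "\<And>i. i \<in># M \<Longrightarrow> mset_set (set_mset (f i)) = f i"
  shows "count (\<Sum>\<^sub># (image_mset f M)) c = (\<Sum>i | i \<in># M \<and> c \<in># f i. count M i)"
proof -
  have count: "count (f i) c = (if c \<in># f i then 1 else 0)" if "i \<in># M" for i
    using assms[OF that] by (metis count_mset_set(1,3) finite_set_mset)
  then have "count (\<Sum>\<^sub># (image_mset f M)) c = size (filter_mset (\<lambda>i. c \<in># f i) M)"
    by (induction M) auto
  also have "\<dots> = (\<Sum>i | i \<in># M \<and> c \<in># f i. count M i)"
    unfolding size_multiset_overloaded_eq by (rule sum.cong) auto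
  finally show ?thesis .
qed

text \<open>The graph has one vertex per clause and one per inference; multiplicities become the
  flow. Each inference accounts for itself and at most three clauses, and \<open>A\<close> for the
  final \<open>1\<close>.\<close>

lemma derives_imp_circular_proof:
  fixes H :: "'x clause set"
  assumes "derives H k {#} {#A#}" "A \<notin> H"
  shows "\<exists>P :: (nat, 'x) preproof. circular_proof P H A \<and> proof_length P \<le> 4 * k + 1"
proof -
  obtain M N where M: "size M \<le> k" "\<forall>i \<in># M. proper i" and N: "set_mset N \<subseteq> H"
    and flow: "{#A#} + all_premises M \<subseteq># N + all_conclusions M"
    using assms(1) unfolding derives_def by auto
  define J where "J = set_mset (add_mset A (all_premises M + all_conclusions M))"
  define I where "I = set_mset M"
  have fin: "finite J" "finite I" by (simp_all add: J_def I_def)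
  obtain f0 :: "'x clause \<Rightarrow> nat" and g0 :: "'x inference \<Rightarrow> nat"
    where inj0: "inj_on f0 J" "inj_on g0 I"
    using finite_imp_inj_to_nat_seg[OF fin(1)] finite_imp_inj_to_nat_seg[OF fin(2)] by blast
  \<comment> \<open>Parity separates formula-vertices (even) from inference-vertices (odd).\<close>
  define f where "f c = 2 * f0 c" for c
  define g where "g i = 2 * g0 i + 1" for i
  have inj: "inj_on f J" "inj_on g I"
    using inj0 by (auto simp: f_def g_def inj_on_def)
  have disj: "f c \<noteq> g i" for c i
    unfolding f_def g_def by presburger
  have premJ: "c \<in> J" if "i \<in> I" "c \<in># rule_premises i" for i c
    using that by (auto simp: I_def J_def)
  have conclJ: "c \<in> J" if "i \<in> I" "c \<in># rule_conclusions i" for i c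
    using that by (auto simp: I_def J_def)
  define E where "E = {(f c, g i) | c i. i \<in> I \<and> c \<in># rule_premises i} \<union>
      {(g i, f c) | c i. i \<in> I \<and> c \<in># rule_conclusions i}"
  define P :: "(nat, 'x) preproof" where
    "P = \<lparr>proof_graph = \<lparr>pverts = f ` J \<union> g ` I, parcs = E\<rparr>, formula_verts = f ` J,
      inference_verts = g ` I, clause_at = inv_into J f, inference_at = inv_into I g\<rparr>"
  define F where "F w = real (count M (inv_into I g w))" for w
  have EJ: "E \<subseteq> f ` J \<times> g ` I \<union> g ` I \<times> f ` J"
    unfolding E_def using premJ conclJ by auto
  have in_g: "in_nbrs P (g i) = f ` set_mset (rule_premises i)"
    and out_g: "out_nbrs P (g i) = f ` set_mset (rule_conclusions i)" if "i \<in> I" for i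
    using that inj(2) disj disj[symmetric]
    by (auto simp: in_nbrs_def out_nbrs_def P_def E_def inj_on_def)
  have in_f: "in_nbrs P (f c) = g ` {i. i \<in># M \<and> c \<in># rule_conclusions i}"
    and out_f: "out_nbrs P (f c) = g ` {i. i \<in># M \<and> c \<in># rule_premises i}" if "c \<in> J" for c
  proof -
    have "(w, f c) \<in> E \<longleftrightarrow> (\<exists>c' i. f c = f c' \<and> w = g i \<and> i \<in> I \<and> c' \<in># rule_conclusions i)" for w
      using disj by (auto simp: E_def)
    then have "(w, f c) \<in> E \<longleftrightarrow> (\<exists>i. w = g i \<and> i \<in> I \<and> c \<in># rule_conclusions i)" for w
      using that conclJ inj_on_eq_iff[OF inj(1)] by metis
    then show "in_nbrs P (f c) = g ` {i. i \<in># M \<and> c \<in># rule_conclusions i}"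
      by (auto simp: in_nbrs_def P_def I_def)
    have "(f c, w) \<in> E \<longleftrightarrow> (\<exists>c' i. f c = f c' \<and> w = g i \<and> i \<in> I \<and> c' \<in># rule_premises i)" for w
      using disj by (auto simp: E_def)
    then have "(f c, w) \<in> E \<longleftrightarrow> (\<exists>i. w = g i \<and> i \<in> I \<and> c \<in># rule_premises i)" for w
      using that premJ inj_on_eq_iff[OF inj(1)] by metis
    then show "out_nbrs P (f c) = g ` {i. i \<in># M \<and> c \<in># rule_premises i}"
      by (auto simp: out_nbrs_def P_def I_def)
  qed
  have lab: "image_mset (clause_at P) (mset_set (f ` S)) = mset_set S" if "S \<subseteq> J" for S
  proof -
    have "mset_set (f ` S) = image_mset f (mset_set S)"
      using inj(1) that by (metis image_mset_mset_set inj_on_subset)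
    then have "image_mset (clause_at P) (mset_set (f ` S)) =
        image_mset (\<lambda>c. inv_into J f (f c)) (mset_set S)"
      by (simp add: P_def multiset.map_comp comp_def)
    also have "\<dots> = image_mset (\<lambda>c. c) (mset_set S)"
      using that inj(1) finite_subset[OF that fin(1)] by (intro image_mset_cong) auto
    finally show ?thesis by simp
  qed
  have pre: "circular_preproof P"
    unfolding circular_preproof_def
  proof (intro conjI ballI)
    show "pair_fin_digraph (proof_graph P)"
      using EJ fin by unfold_locales (auto simp: P_def intro: finite_subset)
    fix w assume "w \<in> inference_verts P"
    then obtain i where w: "w = g i" and i: "i \<in> I" by (auto simp: P_def)
    have "inference_at P (g i) = i" using i inj(2) by (simp add: P_def)
    have p: "proper i" using i M(2) by (simp add: I_def)
    have "set_mset (rule_premises i) \<subseteq> J" "set_mset (rule_conclusions i) \<subseteq> J"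
      using premJ[OF i] conclJ[OF i] by auto
    then show "image_mset (clause_at P) (mset_set (in_nbrs P w)) = rule_premises (inference_at P w)"
      "image_mset (clause_at P) (mset_set (out_nbrs P w)) = rule_conclusions (inference_at P w)"
      using proper_distinct[OF p] in_g[OF i] out_g[OF i] \<open>inference_at P (g i) = i\<close>
      by (simp_all add: w lab)
  next
    show "formula_verts P \<inter> inference_verts P = {}"
      using disj by (auto simp: P_def)
  qed (use EJ in \<open>auto simp: P_def\<close>)
  have sumF: "(\<Sum>w \<in> g ` S. F w) = real (\<Sum>i \<in> S. count M i)" if "S \<subseteq> I" for S
  proof -
    have "(\<Sum>w \<in> g ` S. F w) = (\<Sum>i \<in> S. F (g i))"
      using inj(2) that by (subst sum.reindex) (auto intro: inj_on_subset)
    also have "\<dots> = (\<Sum>i \<in> S. real (count M i))"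
      using inj(2) that by (intro sum.cong) (auto simp: F_def subset_iff)
    finally show ?thesis by simp
  qed
  have bal: "balance P F (f c) = real (count (all_conclusions M) c) - real (count (all_premises M) c)"
    if "c \<in> J" for c
  proof -
    have "(\<Sum>w \<in> in_nbrs P (f c). F w) = real (count (all_conclusions M) c)"
      using M(2) unfolding in_f[OF that]
      by (subst sumF) (auto simp: I_def count_sum_image_mset proper_distinct)
    moreover have "(\<Sum>w \<in> out_nbrs P (f c). F w) = real (count (all_premises M) c)"
      using M(2) unfolding out_f[OF that]
      by (subst sumF) (auto simp: I_def count_sum_image_mset proper_distinct)
    ultimately show ?thesis
      by (simp add: balance_def)
  qed
  have cnt: "count {#A#} c + count (all_premises M) c \<le> count N c + count (all_conclusions M) c" for c
    using mset_subset_eq_count[OF flow, of c] by (simp only: count_union)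
  have "flow_assignment P F"
    using inj(2) by (auto simp: flow_assignment_def P_def F_def I_def)
  moreover have "clause_at P u \<in> H" if "u \<in> sources P F" for u
  proof -
    have "u \<in> f ` J" "balance P F u < 0"
      using that by (simp_all add: sources_def P_def)
    then obtain c where c: "u = f c" "c \<in> J" "balance P F (f c) < 0"
      by blast
    \<comment> \<open>At a source more copies of \<open>c\<close> are consumed than concluded, and
      by \<open>cnt\<close> only \<open>N\<close> can supply the deficit.\<close>
    then have "count N c > 0"
      using bal[OF c(2)] cnt[of c] by linarith
    then have "c \<in> H" using N by auto
    with c inj(1) show ?thesis by (simp add: P_def)
  qed
  moreover have "\<exists>u \<in> sinks P F. clause_at P u = A"
  proof
    have A: "A \<in> J" by (simp add: J_def)
    then show "clause_at P (f A) = A" using inj(1) by (simp add: P_def)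
    \<comment> \<open>As \<open>A\<close> is no hypothesis, its demanded extra copy must come from
      conclusions, so its balance is at least 1.\<close>
    have "count N A = 0" using N assms(2) by (auto simp: count_eq_zero_iff)
    then show "f A \<in> sinks P F"
      using bal[OF A] cnt[of A] A by (simp add: sinks_def P_def)
  qed
  ultimately have "circular_proof P H A"
    using pre unfolding circular_proof_def by blast
  moreover have "proof_length P \<le> 4 * k + 1"
  proof -
    have "proof_length P \<le> card (f ` J) + card (g ` I)"
      by (simp add: proof_length_def P_def card_Un_le)
    also have "\<dots> \<le> card J + card I"
      using fin by (intro add_mono card_image_le)
    also have "card J \<le> 3 * size M + 1"
    proof -
      have "card J \<le> size (add_mset A (all_premises M + all_conclusions M))"
        unfolding J_def by (rule card_set_mset_le)
      with size_all[of M] show ?thesis by simp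
    qed
    also have "card I \<le> size M"
      unfolding I_def by (rule card_set_mset_le)
    finally show ?thesis using M(1) by simp
  qed
  ultimately show ?thesis by blast
qed

text \<open>For \<open>n = 0\<close> the only pigeon clause would itself be empty.\<close>

lemma empty_notin_PHP: "n \<ge> 1 \<Longrightarrow> {||} \<notin> PHP n"
  by (auto simp: PHP_def)

theorem corollary1:
  shows "\<exists>p :: real poly. \<forall>n \<ge> 1. \<exists>P :: (nat, nat \<times> nat) preproof.
           circular_refutation P (PHP n) \<and> real (proof_length P) \<le> poly p (real n)"
proof (rule exI, intro allI impI)
  \<comment> \<open>This is \<open>4 * k + 1\<close> for the bound \<open>k\<close> of
    \<open>derives_PHP\<close>, with \<open>[:0, 1:]\<close> standing for \<open>n\<close> and
    \<open>[:1, 1:]\<close> for \<open>n + 1\<close>.\<close>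
  let ?p = "4 * ([:0, 1:] * [:1, 1:] ^ 3 + [:1, 1:] * [:0, 1:] ^ 2) + 1 :: real poly"
  fix n :: nat assume "n \<ge> 1"
  from derives_imp_circular_proof[OF derives_PHP empty_notin_PHP[OF this]]
  obtain P :: "(nat, nat \<times> nat) preproof" where P: "circular_proof P (PHP n) {||}"
    "proof_length P \<le> 4 * (n * (n + 1) ^ 3 + (n + 1) * (n * n)) + 1"
    by blast
  from P(2) have "real (proof_length P) \<le>
      real (4 * (n * (n + 1) ^ 3 + (n + 1) * (n * n)) + 1)"
    by (simp only: of_nat_le_iff)
  also have "\<dots> = poly ?p (real n)"
    by (simp add: power2_eq_square algebra_simps)
  finally show "\<exists>P :: (nat, nat \<times> nat) preproof.
      circular_refutation P (PHP n) \<and> real (proof_length P) \<le> poly ?p (real n)"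
    using P(1) unfolding circular_refutation_def by blast
qed

end
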